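(* Let $M\ge2$, $N\ge1$ be integers, let $Q_\tau\in\mathbb{R}^{N\times N}$ be entrywise non-negative with every row summing to $1$, and for $m=1,\dots,M$ let $\gamma_m,\alpha_m,\beta_m>0$ with $\gamma_m+\alpha_m+\beta_m=1$. Let $P_\tau,\Gamma\in\mathbb{R}^{MN\times MN}$ be the stacked propagation matrix and residual matrix, and $\Pi$ the centering projection, all defined in the context. Then: (i) (Propagation without residual.) If $v\neq0$ is a centered eigenvector of $P_\tau$, i.e. $\Pi v=v$ and $P_\tau v=\mu v$, with $|\mu|<1$, then the $K$-hop propagation without residual, $\mathbf{H}_{k+1}=P_\tau\mathbf{H}_k$, acts on $v$ by the scalar response $$g_{\mathrm{nores}}(\mu,K)=\mu^K,\qquad\text{i.e. } P_\tau^K v=\mu^K v,$$ which tends to $0$ as $K\to\infty$. (ii) (Propagation with residual.) For the propagation with residual injection, $\mathbf{H}_{k+1}=P_\tau\mathbf{H}_k+\Gamma\mathbf{H}_0$, the fixed-point response (the linear operator sending $\mathbf{H}_0$ to the fixed point) is $$g_{\mathrm{res}}(P_\tau)=(I-P_\tau)^{-1}\Gamma,$$ which is finite (i.e. $I-P_\tau$ is invertible) because $\rho(P_\tau)<1$, and it is non-zero on centered input components retained by $\Gamma$: for every $v$ with $\Pi v=v$ and $\Gamma v\neq0$, $(I-P_\tau)^{-1}\Gamma v\neq0$.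
   Context: $N$ is the number of graph nodes and $M$ the number of modalities. Vectors in $\mathbb{C}^{MN}$ are viewed as stackings of $M$ blocks of length $N$, one per modality. The matrix $P_\tau$ is the $M\times M$ block matrix with $N\times N$ blocks whose $(m,m)$ block is $\alpha_m Q_\tau$ and whose $(m,n)$ block, $n\ne m$, is $\frac{\beta_m}{M-1}Q_\tau$. The matrix $\Gamma$ is block diagonal with $m$-th diagonal block $\gamma_m I_N$. The centering projection $\Pi$ removes the component constant over nodes in each block: $\Pi=I_M\otimes(I_N-\frac1N\mathbf{1}\mathbf{1}^\top)$, with $\mathbf{1}\in\mathbb{R}^N$ the all-ones vector. $\rho(\cdot)$ is spectral radius and $I$ the identity of size $MN$. *)

theory Defs
  imports
    "Jordan_Normal_Form.Gauss_Jordan_Elimination"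
    "Jordan_Normal_Form.Spectral_Radius"
begin

text \<open>
  Modalities are numbered \<open>0, \<dots>, M - 1\<close> and nodes \<open>0, \<dots>, N - 1\<close>; entry \<open>i\<close> of block \<open>m\<close> of a
  stacked vector has position \<open>m * N + i\<close>.
\<close>

definition block_mat :: "nat \<Rightarrow> nat \<Rightarrow> (nat \<Rightarrow> nat \<Rightarrow> 'a mat) \<Rightarrow> 'a mat" where
  "block_mat M N B =
     mat (M * N) (M * N) (\<lambda>(i, j). B (i div N) (j div N) $$ (i mod N, j mod N))"

definition prop_mat ::
  "nat \<Rightarrow> nat \<Rightarrow> (nat \<Rightarrow> real) \<Rightarrow> (nat \<Rightarrow> real) \<Rightarrow> real mat \<Rightarrow> real mat" where
  "prop_mat M N \<alpha> \<beta> Q =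
     block_mat M N (\<lambda>m n. if n = m then \<alpha> m \<cdot>\<^sub>m Q else (\<beta> m / (real M - 1)) \<cdot>\<^sub>m Q)"

definition resid_mat :: "nat \<Rightarrow> nat \<Rightarrow> (nat \<Rightarrow> real) \<Rightarrow> real mat" where
  "resid_mat M N \<gamma> = block_mat M N (\<lambda>m n. if n = m then \<gamma> m \<cdot>\<^sub>m 1\<^sub>m N else 0\<^sub>m N N)"

definition centering_mat :: "nat \<Rightarrow> nat \<Rightarrow> real mat" where
  "centering_mat M N =
     block_mat M N (\<lambda>m n. if n = m then 1\<^sub>m N - (1 / real N) \<cdot>\<^sub>m mat N N (\<lambda>_. 1) else 0\<^sub>m N N)"

abbreviation cmat :: "real mat \<Rightarrow> complex mat" where
  "cmat \<equiv> map_mat complex_of_real"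

definition nores_step :: "real mat \<Rightarrow> complex vec \<Rightarrow> complex vec" where
  "nores_step P H = cmat P *\<^sub>v H"

definition res_step :: "real mat \<Rightarrow> real mat \<Rightarrow> complex vec \<Rightarrow> complex vec \<Rightarrow> complex vec" where
  "res_step P G H\<^sub>0 H = cmat P *\<^sub>v H + cmat G *\<^sub>v H\<^sub>0"

definition g_nores :: "complex \<Rightarrow> nat \<Rightarrow> complex" where
  "g_nores \<mu> K = \<mu> ^ K"

text \<open>
  \<^const>\<open>mat_inverse\<close> returns \<^const>\<open>None\<close> on singular matrices, so \<open>g_res\<close> is the intended matrix
  only when \<open>I - P\<close> is invertible.
\<close>

definition g_res :: "real mat \<Rightarrow> real mat \<Rightarrow> real mat" where
  "g_res P G = the (mat_inverse (1\<^sub>m (dim_row P) - P)) * G"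

end

theory Submission
  imports Defs
begin

text \<open>
  Row \<open>i\<close> of block \<open>m\<close> of \<open>P\<close> is non-negative with sum \<open>\<alpha> m + \<beta> m = 1 - \<gamma> m < 1\<close>, since each block is
  a multiple of a row-stochastic matrix. Comparing entries at a coordinate of maximal modulus of an
  eigenvector, every eigenvalue of \<open>P\<close> is below \<open>1\<close> in modulus. Hence \<open>\<rho>(P) < 1\<close> and \<open>1\<close> is not an
  eigenvalue, so \<open>I - P\<close> is invertible; the remaining claims follow by multiplying with \<open>I - P\<close> or
  its inverse.
\<close>

lemma block_mat_carrier [simp]: "block_mat M N B \<in> carrier_mat (M * N) (M * N)"
  by (simp add: block_mat_def)

text \<open>At a coordinate \<open>i\<close> where the modulus of \<open>v\<close> is largest, row
  \<open>i\<close> of \<open>A v = k v\<close> bounds \<open>norm k\<close> by the norm sum of that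
  row. The field is generic because the complex instance serves the spectral radius and the real one
  the determinant of \<open>I - P\<close>.\<close>

lemma eigenvector_norm_less_1:
  fixes A :: "'a::real_normed_field mat"
  assumes A: "A \<in> carrier_mat n n"
    and rows: "\<And>i. i < n \<Longrightarrow> (\<Sum>j<n. norm (A $$ (i, j))) < 1"
    and ev: "eigenvector A v k"
  shows "norm k < 1"
proof -
  have v: "v \<in> carrier_vec n" "v \<noteq> 0\<^sub>v n" "A *\<^sub>v v = k \<cdot>\<^sub>v v"
    using ev A by (auto simp: eigenvector_def)
  \<comment> \<open>A nonzero coordinate makes the index range nonempty, so that
    \<open>Max W\<close> is meaningful, and later makes this maximum positive.\<close>
  then obtain l where l: "l < n" "v $ l \<noteq> 0"
    by (metis carrier_vecD eq_vecI index_zero_vec)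
  define W where "W = (\<lambda>j. norm (v $ j)) ` {..<n}"
  have W: "finite W" "W \<noteq> {}"
    using l by (auto simp: W_def)
  then have "Max W \<in> (\<lambda>j. norm (v $ j)) ` {..<n}"
    using Max_in[OF W] by (simp only: W_def)
  then obtain i where i: "i < n" "norm (v $ i) = Max W"
    by (metis imageE lessThan_iff)
  have le: "norm (v $ j) \<le> norm (v $ i)" if "j < n" for j
    unfolding i(2) using that W by (intro Max_ge) (auto simp: W_def)
  have pos: "norm (v $ i) > 0"
    using le[OF l(1)] l(2) by (meson less_le_trans zero_less_norm_iff)
  have "k * v $ i = (A *\<^sub>v v) $ i"
    using i v(1,3) by simp
  also have "\<dots> = (\<Sum>j<n. A $$ (i, j) * v $ j)"
    using A v(1) i by (simp add: scalar_prod_def atLeast0LessThan)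
  finally have "norm k * norm (v $ i) \<le> (\<Sum>j<n. norm (A $$ (i, j) * v $ j))"
    by (metis norm_mult norm_sum)
  also have "\<dots> \<le> (\<Sum>j<n. norm (A $$ (i, j)) * norm (v $ i))"
    using le by (intro sum_mono) (auto simp: norm_mult intro!: mult_left_mono)
  also have "\<dots> = (\<Sum>j<n. norm (A $$ (i, j))) * norm (v $ i)"
    by (simp add: sum_distrib_right)
  also have "\<dots> < 1 * norm (v $ i)"
    using rows[OF i(1)] pos by (intro mult_strict_right_mono)
  finally show ?thesis
    using pos by simp
qed

text \<open>For \<open>n > 0\<close> the spectral radius is the modulus of some eigenvalue, so
  bounding each eigenvalue suffices; for \<open>n = 0\<close> the spectrum would be empty.\<close>

lemma spectral_radius_less_1:
  assumes A: "A \<in> carrier_mat n n" and "n > 0"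
    and rows: "\<And>i. i < n \<Longrightarrow> (\<Sum>j<n. norm (A $$ (i, j))) < 1"
  shows "spectral_radius A < 1"
  using spectral_radius_mem_max(1)[OF assms(1,2)] eigenvector_norm_less_1[OF A rows]
  by (auto simp: spectrum_def eigenvalue_def)

text \<open>A singular \<open>I - A\<close> kills some nonzero \<open>v\<close>, which is then an
  eigenvector of \<open>A\<close> for 1; the row bound excludes this.\<close>

lemma det_one_minus_nonzero:
  fixes A :: "'a::real_normed_field mat"
  assumes A: "A \<in> carrier_mat n n"
    and rows: "\<And>i. i < n \<Longrightarrow> (\<Sum>j<n. norm (A $$ (i, j))) < 1"
  shows "det (1\<^sub>m n - A) \<noteq> 0"
proof
  assume "det (1\<^sub>m n - A) = 0"
  moreover have I: "1\<^sub>m n - A \<in> carrier_mat n n"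
    using A by (rule minus_carrier_mat)
  ultimately obtain v where v: "v \<in> carrier_vec n" "v \<noteq> 0\<^sub>v n" "(1\<^sub>m n - A) *\<^sub>v v = 0\<^sub>v n"
    using det_0_iff_vec_prod_zero_field by blast
  have Av: "A *\<^sub>v v \<in> carrier_vec n"
    using A v(1) by simp
  have "v - A *\<^sub>v v = 0\<^sub>v n"
    using v A by (simp add: minus_mult_distrib_mat_vec[of _ n n])
  then have "v $ i = (A *\<^sub>v v) $ i" if "i < n" for i
    using that Av v(1) by (metis carrier_vecD index_minus_vec(1) index_zero_vec(1) right_minus_eq)
  then have "A *\<^sub>v v = 1 \<cdot>\<^sub>v v"
    using A v(1) by (intro eq_vecI) auto
  then have "eigenvector A v 1"
    using v A by (simp add: eigenvector_def)
  from eigenvector_norm_less_1[OF A rows this] show False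
    by simp
qed

text \<open>Resolves the \<open>the\<close> in \<open>g_res\<close>: a nonzero determinant makes
  \<open>A\<close> a unit, so \<open>mat_inverse\<close> cannot return \<open>None\<close>.\<close>

lemma mat_inverse_the:
  fixes A :: "'a::field mat"
  assumes A: "A \<in> carrier_mat n n" and "det A \<noteq> 0"
  shows "the (mat_inverse A) \<in> carrier_mat n n"
    and "A * the (mat_inverse A) = 1\<^sub>m n"
    and "the (mat_inverse A) * A = 1\<^sub>m n"
proof -
  \<comment> \<open>The argument \<open>b\<close> is a dummy of the matrix ring; fixing it to
    \<open>()\<close> puts both facts in the same ring.\<close>
  have "mat_inverse A \<noteq> None"
    using mat_inverse(1)[OF A, where b = "()"] det_non_zero_imp_unit[OF assms, where b = "()"] by blast
  then obtain B where "mat_inverse A = Some B"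
    by blast
  with mat_inverse(2)[OF A this]
  show "the (mat_inverse A) \<in> carrier_mat n n" "A * the (mat_inverse A) = 1\<^sub>m n"
    "the (mat_inverse A) * A = 1\<^sub>m n"
    by auto
qed

lemma invertible_mat_det:
  fixes A :: "'a::field mat"
  assumes A: "A \<in> carrier_mat n n" and "det A \<noteq> 0"
  shows "invertible_mat A"
  using mat_inverse_the[OF assms] A by (auto simp: invertible_mat_def inverts_mat_def)

text \<open>Column \<open>n * N + j\<close> lies in block column \<open>n\<close> at offset
  \<open>j\<close>, so a full row splits into rows of blocks. Leaving \<open>f\<close> open allows
  absolute values to be summed.\<close>

lemma sum_block_row:
  assumes "i < M * N"
  shows "(\<Sum>j<M * N. f (block_mat M N B $$ (i, j)))
    = (\<Sum>n<M. \<Sum>j<N. f (B (i div N) n $$ (i mod N, j)))"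
proof -
  have "(\<Sum>j = n * N..<n * N + N. f (block_mat M N B $$ (i, j)))
    = (\<Sum>j<N. f (B (i div N) n $$ (i mod N, j)))" if "n < M" for n
  proof -
    have "n * N + j < M * N" if "j < N" for j
    proof -
      have "n * N + j < Suc n * N" using that by simp
      also have "\<dots> \<le> M * N" using \<open>n < M\<close> by (intro mult_le_mono1) simp
      finally show ?thesis .
    qed
    moreover have "(\<Sum>j = n * N..<n * N + N. f (block_mat M N B $$ (i, j)))
        = (\<Sum>j<N. f (block_mat M N B $$ (i, n * N + j)))"
      by (rule sum.reindex_bij_witness[of _ "\<lambda>j. n * N + j" "\<lambda>j. j - n * N"]) auto
    ultimately show ?thesis
      using assms by (auto simp: block_mat_def intro!: sum.cong)
  qed
  then show ?thesis
    by (simp flip: sum.nat_group)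
qed

text \<open>A row crosses the diagonal block and \<open>M - 1\<close> off-diagonal blocks. Each
  contributes its scalar, as the rows of \<open>Q\<close> are non-negative with sum 1, and the
  number of off-diagonal blocks cancels the denominator.\<close>

lemma prop_mat_row_sum:
  fixes M N :: nat
  assumes "M \<ge> 2" and i: "i < M * N"
    and Q: "Q \<in> carrier_mat N N"
    and nonneg: "\<And>i j. i < N \<Longrightarrow> j < N \<Longrightarrow> Q $$ (i, j) \<ge> 0"
    and stoch: "\<And>i. i < N \<Longrightarrow> (\<Sum>j<N. Q $$ (i, j)) = 1"
    and pos: "\<And>m. m < M \<Longrightarrow> \<alpha> m > 0 \<and> \<beta> m > 0"
  shows "(\<Sum>j<M * N. \<bar>prop_mat M N \<alpha> \<beta> Q $$ (i, j)\<bar>) = \<alpha> (i div N) + \<beta> (i div N)"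
proof -
  define m where "m = i div N"
  have N: "N > 0"
    using i by (cases N) auto
  have m: "m < M" and r: "i mod N < N"
    using i N by (auto simp: m_def less_mult_imp_div_less)
  have row: "(\<Sum>j<N. \<bar>(c \<cdot>\<^sub>m Q) $$ (i mod N, j)\<bar>) = c" if "c \<ge> 0" for c
  proof -
    have "(\<Sum>j<N. \<bar>(c \<cdot>\<^sub>m Q) $$ (i mod N, j)\<bar>) = (\<Sum>j<N. c * Q $$ (i mod N, j))"
      using Q r nonneg that by (intro sum.cong) (auto simp: abs_mult)
    also have "\<dots> = c"
      using stoch[OF r] by (simp flip: sum_distrib_left)
    finally show ?thesis .
  qed
  have "(\<Sum>j<M * N. \<bar>prop_mat M N \<alpha> \<beta> Q $$ (i, j)\<bar>)
    = (\<Sum>n<M. if n = m then \<alpha> m else \<beta> m / (real M - 1))"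
    unfolding prop_mat_def sum_block_row[OF i]
    using row[of "\<alpha> m"] row[of "\<beta> m / (real M - 1)"] pos[OF m] \<open>M \<ge> 2\<close>
    by (intro sum.cong) (simp_all add: m_def)
  also have "\<dots> = \<alpha> m + (\<Sum>n\<in>{..<M} - {m}. \<beta> m / (real M - 1))"
    using m by (subst sum.remove[of _ m]) auto
  \<comment> \<open>By \<open>M \<ge> 2\<close> the cardinality \<open>M - 1\<close>, a natural
    subtraction, agrees with \<open>real M - 1\<close>, which is nonzero.\<close>
  also have "\<dots> = \<alpha> m + \<beta> m"
    using m \<open>M \<ge> 2\<close> by (simp add: of_nat_diff)
  finally show ?thesis
    by (simp add: m_def)
qed

lemma nores_step_funpow:
  assumes "P \<in> carrier_mat n n" and ev: "eigenvector (cmat P) v \<mu>"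
  shows "(nores_step P ^^ K) v = \<mu> ^ K \<cdot>\<^sub>v v"
proof (induction K)
  case 0
  then show ?case by simp
next
  case (Suc K)
  have v: "v \<in> carrier_vec n" "cmat P *\<^sub>v v = \<mu> \<cdot>\<^sub>v v"
    using assms by (auto simp: eigenvector_def)
  have "(nores_step P ^^ Suc K) v = \<mu> ^ K \<cdot>\<^sub>v (cmat P *\<^sub>v v)"
    using Suc assms(1) v(1) mult_mat_vec[of "cmat P" n n v "\<mu> ^ K"]
    by (simp add: nores_step_def[of P "\<mu> ^ K \<cdot>\<^sub>v v"])
  then show ?case
    using v(2) by (simp add: smult_smult_assoc power_commutes)
qed

text \<open>Moving \<open>A H\<close> to the other side gives \<open>(I - A) H = b\<close>. Then
  \<open>B (I - A) = I\<close> yields uniqueness of the solution and \<open>(I - A) B = I\<close>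
  its existence.\<close>

lemma resolvent_solves:
  fixes A B :: "'a::comm_ring_1 mat"
  assumes A: "A \<in> carrier_mat n n" and B: "B \<in> carrier_mat n n"
    and AB: "(1\<^sub>m n - A) * B = 1\<^sub>m n" and BA: "B * (1\<^sub>m n - A) = 1\<^sub>m n"
    and H: "H \<in> carrier_vec n" and b: "b \<in> carrier_vec n"
  shows "A *\<^sub>v H + b = H \<longleftrightarrow> H = B *\<^sub>v b"
proof -
  have I: "1\<^sub>m n - A \<in> carrier_mat n n"
    using A by (rule minus_carrier_mat)
  have AH: "A *\<^sub>v H \<in> carrier_vec n"
    using A H by simp
  have "A *\<^sub>v H + b = H \<longleftrightarrow> (\<forall>i<n. (A *\<^sub>v H) $ i + b $ i = H $ i)"
    using AH H b by (simp add: vec_eq_iff)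
  also have "\<dots> \<longleftrightarrow> (\<forall>i<n. H $ i - (A *\<^sub>v H) $ i = b $ i)"
    by (intro all_cong1 imp_cong refl) (auto simp: algebra_simps)
  also have "\<dots> \<longleftrightarrow> H - A *\<^sub>v H = b"
    using A H b by (auto simp: vec_eq_iff)
  also have "H - A *\<^sub>v H = (1\<^sub>m n - A) *\<^sub>v H"
    using A H by (simp add: minus_mult_distrib_mat_vec[of _ n n])
  also have "(1\<^sub>m n - A) *\<^sub>v H = b \<longleftrightarrow> H = B *\<^sub>v b"
  proof
    assume "(1\<^sub>m n - A) *\<^sub>v H = b"
    then show "H = B *\<^sub>v b"
      using assoc_mult_mat_vec[OF B I H] BA H by simp
  next
    assume "H = B *\<^sub>v b"
    then show "(1\<^sub>m n - A) *\<^sub>v H = b"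
      using assoc_mult_mat_vec[OF I B b] AB b by simp
  qed
  finally show ?thesis .
qed

theorem theorem2:
  fixes M N :: nat
    and Q :: "real mat"
    and \<gamma> \<alpha> \<beta> :: "nat \<Rightarrow> real"
  defines "P \<equiv> prop_mat M N \<alpha> \<beta> Q"
    and "\<Gamma> \<equiv> resid_mat M N \<gamma>"
    and "C \<equiv> centering_mat M N"
  assumes "M \<ge> 2" and "N \<ge> 1"
    and "Q \<in> carrier_mat N N"
    and "\<And>i j. i < N \<Longrightarrow> j < N \<Longrightarrow> Q $$ (i, j) \<ge> 0"
    and "\<And>i. i < N \<Longrightarrow> (\<Sum>j<N. Q $$ (i, j)) = 1"
    and "\<And>m. m < M \<Longrightarrow> \<gamma> m > 0 \<and> \<alpha> m > 0 \<and> \<beta> m > 0"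
    and "\<And>m. m < M \<Longrightarrow> \<gamma> m + \<alpha> m + \<beta> m = 1"
  shows
    "(\<forall>\<mu> v. eigenvector (cmat P) v \<mu> \<and> cmat C *\<^sub>v v = v \<and> cmod \<mu> < 1 \<longrightarrow>
        (\<forall>K. (nores_step P ^^ K) v = g_nores \<mu> K \<cdot>\<^sub>v v
           \<and> (cmat P ^\<^sub>m K) *\<^sub>v v = g_nores \<mu> K \<cdot>\<^sub>v v)
        \<and> (\<lambda>K. g_nores \<mu> K) \<longlonglongrightarrow> 0)
   \<and> spectral_radius (cmat P) < 1
   \<and> invertible_mat (1\<^sub>m (M * N) - P)
   \<and> (\<forall>H\<^sub>0 \<in> carrier_vec (M * N). \<forall>H \<in> carrier_vec (M * N).
        res_step P \<Gamma> H\<^sub>0 H = H \<longleftrightarrow> H = cmat (g_res P \<Gamma>) *\<^sub>v H\<^sub>0)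
   \<and> (\<forall>v \<in> carrier_vec (M * N).
        cmat C *\<^sub>v v = v \<and> cmat \<Gamma> *\<^sub>v v \<noteq> 0\<^sub>v (M * N) \<longrightarrow>
        cmat (g_res P \<Gamma>) *\<^sub>v v \<noteq> 0\<^sub>v (M * N))"
proof -
  let ?n = "M * N"
  have P: "P \<in> carrier_mat ?n ?n" and G: "\<Gamma> \<in> carrier_mat ?n ?n"
    by (simp_all add: P_def \<Gamma>_def prop_mat_def resid_mat_def)
  have n: "?n > 0"
    using assms(4,5) by simp
  have rows: "(\<Sum>j<?n. \<bar>P $$ (i, j)\<bar>) < 1" if i: "i < ?n" for i
  proof -
    have m: "i div N < M"
      using i by (simp add: less_mult_imp_div_less)
    have "(\<Sum>j<?n. \<bar>P $$ (i, j)\<bar>) = \<alpha> (i div N) + \<beta> (i div N)"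
      unfolding P_def using assms(9)
      by (intro prop_mat_row_sum[OF assms(4) i assms(6-8)]) auto
    with assms(9,10)[OF m] show ?thesis
      by simp
  qed
  have "spectral_radius (cmat P) < 1"
  proof (rule spectral_radius_less_1[OF _ n])
    show "cmat P \<in> carrier_mat ?n ?n"
      using P by simp
    show "(\<Sum>j<?n. cmod (cmat P $$ (i, j))) < 1" if "i < ?n" for i
      using rows[OF that] P that by simp
  qed
  moreover have I: "1\<^sub>m ?n - P \<in> carrier_mat ?n ?n"
    using P by (rule minus_carrier_mat)
  \<comment> \<open>Taken over the reals, because \<open>g_res\<close> inverts the real
    matrix.\<close>
  have det: "det (1\<^sub>m ?n - P) \<noteq> 0"
    using rows by (intro det_one_minus_nonzero[OF P]) simp
  define R where "R = the (mat_inverse (1\<^sub>m ?n - P))"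
  note R = mat_inverse_the[OF I det, folded R_def]
  have g_res: "g_res P \<Gamma> = R * \<Gamma>"
    using P by (simp add: g_res_def R_def)
  have cR: "cmat R \<in> carrier_mat ?n ?n" and cP: "cmat P \<in> carrier_mat ?n ?n"
    and cG: "cmat \<Gamma> \<in> carrier_mat ?n ?n"
    using R P G by auto
  have cI: "cmat (1\<^sub>m ?n - P) = 1\<^sub>m ?n - cmat P"
    using P by (intro eq_matI) auto
  \<comment> \<open>Complexification is a ring homomorphism, so both inverse identities for
    \<open>R\<close> carry over to \<open>cmat R\<close>, which acts on complex vectors.\<close>
  have cIR: "(1\<^sub>m ?n - cmat P) * cmat R = 1\<^sub>m ?n"
    using of_real_hom.mat_hom_mult[OF I R(1), where ?'a = complex] R(2) cI
    by (simp add: of_real_hom.mat_hom_one)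
  have cRI: "cmat R * (1\<^sub>m ?n - cmat P) = 1\<^sub>m ?n"
    using of_real_hom.mat_hom_mult[OF R(1) I, where ?'a = complex] R(3) cI
    by (simp add: of_real_hom.mat_hom_one)
  \<comment> \<open>The response to \<open>v\<close> is the resolvent applied to the injected source
    \<open>\<Gamma> v\<close>, the form in which \<open>resolvent_solves\<close> applies.\<close>
  have resp: "cmat (g_res P \<Gamma>) *\<^sub>v v = cmat R *\<^sub>v (cmat \<Gamma> *\<^sub>v v)" if "v \<in> carrier_vec ?n" for v
    using of_real_hom.mat_hom_mult[OF R(1) G, where ?'a = complex]
      assoc_mult_mat_vec[OF cR cG that] g_res by simp
  have "res_step P \<Gamma> H\<^sub>0 H = H \<longleftrightarrow> H = cmat (g_res P \<Gamma>) *\<^sub>v H\<^sub>0"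
    if "H\<^sub>0 \<in> carrier_vec ?n" "H \<in> carrier_vec ?n" for H\<^sub>0 H
    unfolding res_step_def resp[OF that(1)]
    using cG that by (intro resolvent_solves[OF cP cR cIR cRI]) auto
  \<comment> \<open>A zero response would make the zero vector the fixed point for the source
    \<open>\<Gamma> v\<close>, and the fixed-point equation would then force
    \<open>\<Gamma> v = 0\<close>.\<close>
  moreover have "cmat (g_res P \<Gamma>) *\<^sub>v v \<noteq> 0\<^sub>v ?n"
    if v: "v \<in> carrier_vec ?n" and nz: "cmat \<Gamma> *\<^sub>v v \<noteq> 0\<^sub>v ?n" for v
  proof
    assume "cmat (g_res P \<Gamma>) *\<^sub>v v = 0\<^sub>v ?n"
    moreover have b: "cmat \<Gamma> *\<^sub>v v \<in> carrier_vec ?n"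
      using cG v by simp
    ultimately have "cmat P *\<^sub>v 0\<^sub>v ?n + cmat \<Gamma> *\<^sub>v v = 0\<^sub>v ?n"
      using resolvent_solves[OF cP cR cIR cRI _ b, of "0\<^sub>v ?n"] resp[OF v] by simp
    moreover have "cmat P *\<^sub>v 0\<^sub>v ?n = 0\<^sub>v ?n"
      using P by (intro eq_vecI) auto
    ultimately show False
      using nz left_zero_vec[OF b] by simp
  qed
  \<comment> \<open>Iterated steps and the matrix power are treated separately, the former by
    induction and the latter by \<open>eigenvector_pow\<close>.\<close>
  moreover have "(\<forall>K. (nores_step P ^^ K) v = g_nores \<mu> K \<cdot>\<^sub>v v
           \<and> (cmat P ^\<^sub>m K) *\<^sub>v v = g_nores \<mu> K \<cdot>\<^sub>v v)
        \<and> (\<lambda>K. g_nores \<mu> K) \<longlonglongrightarrow> 0"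
    if "eigenvector (cmat P) v \<mu>" "cmod \<mu> < 1" for \<mu> v
    using nores_step_funpow[OF P that(1)] eigenvector_pow[OF cP that(1)] LIMSEQ_power_zero[OF that(2)]
    by (simp add: g_nores_def)
  ultimately show ?thesis
    using invertible_mat_det[OF I det] by (intro conjI allI ballI impI) blast+
qed

end
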